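(* Let $G$ be a non-cyclic group of finite order $n$. Then $\omega(\mathcal{RP}(G))<\omega(\mathcal{RP}(\mathbb Z_n))$ and $\chi(\mathcal{RP}(G))<\chi(\mathcal{RP}(\mathbb Z_n))$. Also $\omega(\mathcal{RP}^*(G))<\omega(\mathcal{RP}^*(\mathbb Z_n))$ and $\chi(\mathcal{RP}^*(G))<\chi(\mathcal{RP}^*(\mathbb Z_n))$.
   Context: For a group $G$ with identity $e$, the reduced power graph $\mathcal{RP}(G)$ is the simple graph with vertex set $G$ in which $u,v$ are adjacent if and only if $\langle v\rangle\subset\langle u\rangle$ or $\langle u\rangle\subset\langle v\rangle$, where $\subset$ means proper inclusion. The proper reduced power graph $\mathcal{RP}^*(G)$ is the subgraph of $\mathcal{RP}(G)$ induced on $G\setminus\{e\}$. $\omega$ denotes the clique number and $\chi$ the chromatic number of a graph. $\mathbb Z_n$ is the cyclic group of order $n$. *)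

theory Defs
  imports "HOL-Algebra.Elementary_Groups" "HOL-Library.Ramsey"
begin

text \<open>
  A simple graph is a pair of a vertex set and a set of edges, each edge being a two-element set
  of vertices.  This is the edge representation of \<^const>\<open>clique\<close> in \<^theory>\<open>HOL-Library.Ramsey\<close>.
\<close>

type_synonym 'a sgraph = "'a set \<times> 'a set set"

abbreviation vertices :: "'a sgraph \<Rightarrow> 'a set" where
  "vertices \<equiv> fst"

abbreviation edges :: "'a sgraph \<Rightarrow> 'a set set" where
  "edges \<equiv> snd"

definition induced_sgraph :: "'a sgraph \<Rightarrow> 'a set \<Rightarrow> 'a sgraph" where
  "induced_sgraph \<Gamma> W = (vertices \<Gamma> \<inter> W, {e \<in> edges \<Gamma>. e \<subseteq> W})"

text \<open>The following two numbers are meaningful for graphs with finitely many vertices only.\<close>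

definition clique_number :: "'a sgraph \<Rightarrow> nat" where
  "clique_number \<Gamma> = Max {card K | K. K \<subseteq> vertices \<Gamma> \<and> clique K (edges \<Gamma>)}"

definition proper_coloring :: "'a sgraph \<Rightarrow> nat \<Rightarrow> ('a \<Rightarrow> nat) \<Rightarrow> bool" where
  "proper_coloring \<Gamma> k c \<longleftrightarrow>
     c ` vertices \<Gamma> \<subseteq> {..<k} \<and>
     (\<forall>u \<in> vertices \<Gamma>. \<forall>v \<in> vertices \<Gamma>. {u, v} \<in> edges \<Gamma> \<longrightarrow> c u \<noteq> c v)"

definition chromatic_number :: "'a sgraph \<Rightarrow> nat" where
  "chromatic_number \<Gamma> = (LEAST k. \<exists>c. proper_coloring \<Gamma> k c)"

text \<open>Proper inclusion of the generated subgroups forces \<open>u \<noteq> v\<close>, so there are no loops.\<close>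

definition reduced_power_graph :: "('a, 'b) monoid_scheme \<Rightarrow> 'a sgraph" where
  "reduced_power_graph G =
     (carrier G,
      {{u, v} | u v. u \<in> carrier G \<and> v \<in> carrier G \<and>
         (generate G {v} \<subset> generate G {u} \<or> generate G {u} \<subset> generate G {v})})"

definition proper_reduced_power_graph :: "('a, 'b) monoid_scheme \<Rightarrow> 'a sgraph" where
  "proper_reduced_power_graph G =
     induced_sgraph (reduced_power_graph G) (carrier G - {\<one>\<^bsub>G\<^esub>})"

end

theory Submission
  imports
    Defs
    "HOL-Algebra.Multiplicative_Group"
    "HOL-Computational_Algebra.Primes"
begin

text \<open>
  Write \<open>\<Omega>(m)\<close> for the number of prime factors of \<open>m\<close> counted with multiplicity.  If
  \<open>\<langle>u\<rangle> \<subset> \<langle>v\<rangle>\<close> in a finite group, then the order of \<open>u\<close> is a proper divisor of the order of \<open>v\<close>, so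
  \<open>\<Omega>(ord u) < \<Omega>(ord v)\<close>.  Hence \<open>u \<mapsto> \<Omega>(ord u)\<close> is a proper colouring of the reduced power graph.

  A non-cyclic group of order \<open>n\<close> has no element of order \<open>n\<close>, so every element order is a proper
  divisor of \<open>n\<close> and this colouring takes values below \<open>\<Omega>(n)\<close>.  As the clique number never exceeds
  the chromatic number, both numbers are at most \<open>\<Omega>(n)\<close>.  In \<open>\<int>\<^sub>n\<close>, on the other hand, a maximal
  chain \<open>1 = d\<^sub>0 | d\<^sub>1 | \<dots> | n\<close> of divisors, realised by one element of each order \<open>d\<^sub>i\<close>, is a clique
  with \<open>\<Omega>(n) + 1\<close> vertices, so both numbers are at least \<open>\<Omega>(n) + 1\<close>.

  Removing the identity, which is the only element of colour \<open>0\<close> and belongs to that clique, lowers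
  all these bounds by one.
\<close>

section \<open>Colourings and cliques of finite graphs\<close>

lemma card_clique_le_colours:
  assumes "proper_coloring \<Gamma> k c" and "K \<subseteq> vertices \<Gamma>" and "clique K (edges \<Gamma>)"
  shows "card K \<le> k"
proof -
  have "inj_on c K"
    using assms unfolding proper_coloring_def clique_def inj_on_def by blast
  moreover have "c ` K \<subseteq> {..<k}"
    using assms(1,2) unfolding proper_coloring_def by blast
  ultimately show ?thesis
    using card_inj_on_le[of c K "{..<k}"] by simp
qed

lemma finite_clique_sizes:
  assumes "finite (vertices \<Gamma>)"
  shows "finite {card K | K. K \<subseteq> vertices \<Gamma> \<and> clique K (edges \<Gamma>)}"
  using assms by simp

lemma card_clique_le_clique_number:
  assumes "finite (vertices \<Gamma>)" and "K \<subseteq> vertices \<Gamma>" and "clique K (edges \<Gamma>)"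
  shows "card K \<le> clique_number \<Gamma>"
  unfolding clique_number_def
  by (rule Max_ge[OF finite_clique_sizes]) (use assms in auto)

lemma clique_number_le_colours:
  assumes "finite (vertices \<Gamma>)" and "proper_coloring \<Gamma> k c"
  shows "clique_number \<Gamma> \<le> k"
proof -
  let ?S = "{card K | K. K \<subseteq> vertices \<Gamma> \<and> clique K (edges \<Gamma>)}"
  have "card {} \<in> ?S"
    by (intro CollectI exI[of _ "{}"]) simp
  then have "Max ?S \<in> ?S"
    by (intro Max_in finite_clique_sizes assms(1)) blast
  then show ?thesis
    unfolding clique_number_def using card_clique_le_colours[OF assms(2)] by auto
qed

lemma chromatic_number_le_colours:
  assumes "proper_coloring \<Gamma> k c"
  shows "chromatic_number \<Gamma> \<le> k"
  unfolding chromatic_number_def by (rule Least_le) (use assms in blast)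

text \<open>Some proper colouring must be given, since a loop would make the chromatic number meaningless.\<close>

lemma clique_number_le_chromatic_number:
  assumes "finite (vertices \<Gamma>)" and "proper_coloring \<Gamma> k c"
  shows "clique_number \<Gamma> \<le> chromatic_number \<Gamma>"
proof -
  have "\<exists>c. proper_coloring \<Gamma> (chromatic_number \<Gamma>) c"
    unfolding chromatic_number_def by (rule LeastI[of _ k]) (use assms(2) in blast)
  then show ?thesis
    using clique_number_le_colours[OF assms(1)] by blast
qed

section \<open>Prime factors counted with multiplicity\<close>

text \<open>The number \<open>\<Omega>(n)\<close> of prime factors of \<open>n\<close> counted with multiplicity, with the default value
  \<open>\<Omega>(0) = 0\<close>.\<close>

definition bigomega :: "nat \<Rightarrow> nat" where
  "bigomega n = size (prime_factorization n)"

lemma bigomega_Suc_0 [simp]: "bigomega (Suc 0) = 0"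
  by (simp add: bigomega_def)

lemma bigomega_prime_mult:
  assumes "prime p" and "n > 0"
  shows "bigomega (p * n) = Suc (bigomega n)"
  using assms by (simp add: bigomega_def prime_factorization_mult prime_factorization_prime)

lemma bigomega_strict_mono:
  assumes "m dvd n" and "m \<noteq> n" and "n > 0"
  shows "bigomega m < bigomega n"
proof -
  have "m > 0"
    using assms by (auto intro: gr0I)
  then have "prime_factorization m \<subseteq># prime_factorization n"
    using assms by (simp add: prime_factorization_subset_iff_dvd)
  moreover have "prime_factorization m \<noteq> prime_factorization n"
    using assms(2,3) \<open>m > 0\<close> prime_factorization_unique[of m n] by simp
  ultimately show ?thesis
    unfolding bigomega_def by (intro mset_subset_size) (simp add: subset_mset_def)
qed

lemma bigomega_mono:
  assumes "m dvd n" and "n > 0"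
  shows "bigomega m \<le> bigomega n"
  using bigomega_strict_mono[OF assms(1) _ assms(2)] by (cases "m = n") auto

lemma bigomega_pos:
  assumes "n > 1"
  shows "bigomega n > 0"
  using bigomega_strict_mono[of 1 n] assms by simp

lemma maximal_divisor_chain:
  assumes "n > 0"
  shows "\<exists>D. card D = Suc (bigomega n) \<and> 1 \<in> D \<and> (\<forall>d\<in>D. d dvd n)
           \<and> (\<forall>d\<in>D. \<forall>d'\<in>D. d dvd d' \<or> d' dvd d)"
  using assms
proof (induction n rule: prime_divisors_induct)
  case zero
  then show ?case by simp
next
  case (unit n)
  then show ?case by (intro exI[of _ "{1}"]) simp
next
  case (factor p n)
  then have "prime p" "n > 0" by auto
  then obtain D where D: "card D = Suc (bigomega n)" "1 \<in> D" "\<forall>d\<in>D. d dvd n"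
      "\<forall>d\<in>D. \<forall>d'\<in>D. d dvd d' \<or> d' dvd d"
    using factor.IH by blast
  have "n < p * n"
    using \<open>prime p\<close> \<open>n > 0\<close> prime_gt_1_nat by simp
  then have "p * n \<notin> D"
    using D(3) \<open>n > 0\<close> by (metis dvd_imp_le not_less)
  moreover have "finite D"
    using D(1) by (intro card_ge_0_finite) simp
  ultimately have "card (insert (p * n) D) = Suc (bigomega (p * n))"
    using D(1) bigomega_prime_mult[OF \<open>prime p\<close> \<open>n > 0\<close>] by simp
  moreover have "\<forall>d \<in> insert (p * n) D. d dvd p * n"
    using D(3) by (simp add: dvd_mult)
  moreover have "\<forall>d \<in> insert (p * n) D. \<forall>d' \<in> insert (p * n) D. d dvd d' \<or> d' dvd d"
    using D(3,4) by (simp add: dvd_mult)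
  ultimately show ?case
    using D(2) by (intro exI[of _ "insert (p * n) D"]) simp
qed

section \<open>Element orders and the reduced power graph\<close>

lemma vertices_reduced_power_graph [simp]:
  "vertices (reduced_power_graph G) = carrier G"
  by (simp add: reduced_power_graph_def)

lemma vertices_proper_reduced_power_graph [simp]:
  "vertices (proper_reduced_power_graph G) = carrier G - {\<one>\<^bsub>G\<^esub>}"
  by (auto simp: proper_reduced_power_graph_def induced_sgraph_def)

lemma doubleton_in_edges_reduced_power_graph:
  "{u, v} \<in> edges (reduced_power_graph G) \<longleftrightarrow>
     u \<in> carrier G \<and> v \<in> carrier G \<and>
     (generate G {v} \<subset> generate G {u} \<or> generate G {u} \<subset> generate G {v})"
  by (auto simp: reduced_power_graph_def doubleton_eq_iff)

lemma doubleton_in_edges_proper_reduced_power_graph: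
  "{u, v} \<in> edges (proper_reduced_power_graph G) \<longleftrightarrow>
     {u, v} \<in> edges (reduced_power_graph G) \<and> u \<noteq> \<one>\<^bsub>G\<^esub> \<and> v \<noteq> \<one>\<^bsub>G\<^esub>"
  by (auto simp: proper_reduced_power_graph_def induced_sgraph_def
      doubleton_in_edges_reduced_power_graph)

context group
begin

lemma ord_pos_if_finite:
  assumes "finite (carrier G)" and "a \<in> carrier G"
  shows "ord a > 0"
  using ord_ge_1[OF assms] by simp

lemma generate_subset_imp_ord_dvd:
  assumes "u \<in> carrier G" and "v \<in> carrier G" and "generate G {u} \<subseteq> generate G {v}"
  shows "ord u dvd ord v"
proof -
  have "u \<in> generate G {v}"
    using assms(3) generate.incl[of u "{u}" G] by blast
  then obtain k :: int where k: "u = v [^] k"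
    using generate_pow[OF assms(2)] by blast
  have "u [^] ord v = (v [^] ord v) [^] k"
    using assms(2) by (simp add: k int_pow_pow mult.commute flip: int_pow_int)
  then have "u [^] ord v = \<one>"
    using assms(2) by simp
  then show ?thesis
    using pow_eq_id[OF assms(1)] by blast
qed

lemma generate_psubset_imp_bigomega_less:
  assumes "finite (carrier G)" and "u \<in> carrier G" and "v \<in> carrier G"
    and "generate G {u} \<subset> generate G {v}"
  shows "bigomega (ord u) < bigomega (ord v)"
proof (rule bigomega_strict_mono)
  show "ord u dvd ord v"
    using assms by (intro generate_subset_imp_ord_dvd) auto
  have "finite (generate G {v})"
    using assms(1,3) generate_incl[of "{v}"] by (auto intro: finite_subset)
  then show "ord u \<noteq> ord v"
    using psubset_card_mono[OF _ assms(4)] assms(2,3) by (simp add: generate_pow_card)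
  show "ord v > 0"
    using assms by (intro ord_pos_if_finite)
qed

lemma proper_coloring_reduced_power_graph:
  assumes "finite (carrier G)" and "\<And>u. u \<in> carrier G \<Longrightarrow> bigomega (ord u) \<le> m"
  shows "proper_coloring (reduced_power_graph G) (Suc m) (\<lambda>u. bigomega (ord u))"
proof -
  have "bigomega (ord u) \<noteq> bigomega (ord v)" if "{u, v} \<in> edges (reduced_power_graph G)" for u v
    using that generate_psubset_imp_bigomega_less[OF assms(1)]
    unfolding doubleton_in_edges_reduced_power_graph by (metis less_irrefl)
  then show ?thesis
    using assms(2) by (auto simp: proper_coloring_def less_Suc_eq_le)
qed

lemma bigomega_ord_pos:
  assumes "finite (carrier G)" and "u \<in> carrier G" and "u \<noteq> \<one>"
  shows "bigomega (ord u) > 0"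
  using assms ord_pos_if_finite[of u] ord_eq_1[of u] by (intro bigomega_pos) auto

text \<open>The subtraction does not truncate, as \<open>\<Omega>(ord u) > 0\<close> for \<open>u \<noteq> \<one>\<close>; so the shifted colours still
  separate adjacent vertices.\<close>

lemma proper_coloring_proper_reduced_power_graph:
  assumes "finite (carrier G)" and "\<And>u. u \<in> carrier G \<Longrightarrow> bigomega (ord u) \<le> m"
  shows "proper_coloring (proper_reduced_power_graph G) m (\<lambda>u. bigomega (ord u) - 1)"
proof -
  have "bigomega (ord u) - 1 \<noteq> bigomega (ord v) - 1"
    if "{u, v} \<in> edges (proper_reduced_power_graph G)" for u v
  proof -
    have uv: "{u, v} \<in> edges (reduced_power_graph G)" "u \<noteq> \<one>" "v \<noteq> \<one>"
      "u \<in> carrier G" "v \<in> carrier G"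
      using that by (auto simp: doubleton_in_edges_proper_reduced_power_graph
          doubleton_in_edges_reduced_power_graph)
    then have "bigomega (ord u) \<noteq> bigomega (ord v)"
      using proper_coloring_reduced_power_graph[OF assms] by (auto simp: proper_coloring_def)
    then show ?thesis
      using bigomega_ord_pos[OF assms(1)] uv by (metis Suc_pred' One_nat_def)
  qed
  moreover have "bigomega (ord u) - 1 < m" if "u \<in> carrier G" "u \<noteq> \<one>" for u
    using assms(2)[OF that(1)] bigomega_ord_pos[OF assms(1) that] by linarith
  ultimately show ?thesis
    unfolding proper_coloring_def by auto
qed

text \<open>The powers \<open>x\<^bsup>ord x / d\<^esup>\<close>, where \<open>d\<close> runs through a maximal chain of divisors of \<open>ord x\<close>.\<close>

lemma ex_clique_reduced_power_graph:
  assumes "finite (carrier G)" and "x \<in> carrier G"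
  shows "\<exists>K \<subseteq> carrier G. \<one> \<in> K \<and> card K = Suc (bigomega (ord x))
           \<and> clique K (edges (reduced_power_graph G))"
proof -
  define n where "n = ord x"
  have "n > 0"
    unfolding n_def using assms by (rule ord_pos_if_finite)
  then obtain D where D: "card D = Suc (bigomega n)" "1 \<in> D" "\<And>d. d \<in> D \<Longrightarrow> d dvd n"
      "\<And>d d'. d \<in> D \<Longrightarrow> d' \<in> D \<Longrightarrow> d dvd d' \<or> d' dvd d"
    using maximal_divisor_chain by metis
  define y where "y d = x [^] (n div d)" for d
  have y_closed: "y d \<in> carrier G" for d
    using assms(2) by (simp add: y_def)
  have ord_y: "ord (y d) = d" if "d \<in> D" for d
  proof -
    have "d dvd n"
      using D(3) that by blast
    then obtain q where "n = d * q"
      by blast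
    then have "n div d = q" "q > 0" "gcd n q = q" "n div q = d"
      using \<open>n > 0\<close> by auto
    then show ?thesis
      unfolding y_def ord_pow_gen[OF assms(2)] n_def[symmetric] by simp
  qed
  have inj: "inj_on y D"
    using ord_y by (metis inj_onI)
  have "y 1 = \<one>"
    using assms(2) by (simp add: y_def n_def)
  have sub: "generate G {y d} \<subset> generate G {y d'}"
    if "d \<in> D" "d' \<in> D" "d dvd d'" "d \<noteq> d'" for d d'
  proof -
    have "d' dvd n"
      using D(3) that(2) by blast
    with \<open>d dvd d'\<close> obtain q r where q: "d' = d * q" and r: "n = d' * r"
      by (elim dvdE)
    have "d > 0" "d' > 0"
      using \<open>n > 0\<close> q r by auto
    then have "n div d = (n div d') * q"
      unfolding r q by simp
    then have "y d = y d' [^] q"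
      using assms(2) by (simp add: y_def nat_pow_pow)
    then have "y d = y d' [^] int q"
      by (simp add: int_pow_int)
    then have "y d \<in> generate G {y d'}"
      using generate_pow[OF y_closed] by blast
    then have "generate G {y d} \<subseteq> generate G {y d'}"
      using y_closed by (intro generate_subgroup_incl generate_is_subgroup) auto
    moreover have "generate G {y d} \<noteq> generate G {y d'}"
      using that ord_y y_closed by (metis generate_pow_card)
    ultimately show ?thesis by blast
  qed
  show ?thesis
  proof (intro exI[of _ "y ` D"] conjI)
    show "y ` D \<subseteq> carrier G"
      using y_closed by blast
    show "\<one> \<in> y ` D"
      using D(2) \<open>y 1 = \<one>\<close> by force
    show "card (y ` D) = Suc (bigomega (ord x))"
      using D(1) inj by (simp add: card_image n_def)
    show "clique (y ` D) (edges (reduced_power_graph G))"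
      unfolding clique_def
    proof (intro ballI impI)
      fix u v
      assume "u \<in> y ` D" "v \<in> y ` D" "u \<noteq> v"
      then obtain d d' where dd': "u = y d" "v = y d'" "d \<in> D" "d' \<in> D" "d \<noteq> d'"
        by auto
      then show "{u, v} \<in> edges (reduced_power_graph G)"
        using D(4)[of d d'] sub[of d d'] sub[of d' d] y_closed
        by (auto simp only: doubleton_in_edges_reduced_power_graph)
    qed
  qed
qed

lemma clique_number_reduced_power_graph_ge:
  assumes "finite (carrier G)" and "x \<in> carrier G"
  shows "Suc (bigomega (ord x)) \<le> clique_number (reduced_power_graph G)"
  using ex_clique_reduced_power_graph[OF assms] card_clique_le_clique_number assms(1)
  by (metis vertices_reduced_power_graph)

lemma clique_number_proper_reduced_power_graph_ge:
  assumes "finite (carrier G)" and "x \<in> carrier G"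
  shows "bigomega (ord x) \<le> clique_number (proper_reduced_power_graph G)"
proof -
  obtain K where K: "K \<subseteq> carrier G" "\<one> \<in> K" "card K = Suc (bigomega (ord x))"
      "clique K (edges (reduced_power_graph G))"
    using ex_clique_reduced_power_graph[OF assms] by blast
  have "clique (K - {\<one>}) (edges (proper_reduced_power_graph G))"
    using K(4) by (simp add: clique_def doubleton_in_edges_proper_reduced_power_graph)
  then have "card (K - {\<one>}) \<le> clique_number (proper_reduced_power_graph G)"
    using K(1) assms(1) by (intro card_clique_le_clique_number) auto
  then show ?thesis
    using K(2,3) by simp
qed

lemma cyclic_group_if_ord_eq_order:
  assumes "finite (carrier G)" and "x \<in> carrier G" and "ord x = order G"
  shows "cyclic_group G"
proof -
  have "generate G {x} = carrier G"
    using assms generate_incl[of "{x}"]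
    by (intro card_subset_eq) (auto simp: order_def simp flip: generate_pow_card)
  then show ?thesis
    unfolding cyclic_group using generate_pow[OF assms(2)] assms(2) by blast
qed

end

lemma ord_one_integer_mod_group:
  assumes "n > 1"
  shows "group.ord (integer_mod_group n) 1 = n"
proof (rule dvd_antisym)
  interpret Z: group "integer_mod_group n" by simp
  have one: "1 \<in> carrier (integer_mod_group n)"
    using assms by simp
  show "Z.ord 1 dvd n"
    using Z.pow_eq_id[OF one, of n] by simp
  have "int n dvd int (Z.ord 1)"
    using Z.pow_ord_eq_1[OF one] by (auto simp: mod_eq_0_iff_dvd)
  then show "n dvd Z.ord 1"
    by simp
qed

theorem corollary2p2:
  fixes G :: "('a, 'b) monoid_scheme" and n :: nat
  assumes "group G" and "finite (carrier G)" and "order G = n"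
    and "\<not> cyclic_group G"
  shows "clique_number (reduced_power_graph G)
           < clique_number (reduced_power_graph (integer_mod_group n))
       \<and> chromatic_number (reduced_power_graph G)
           < chromatic_number (reduced_power_graph (integer_mod_group n))
       \<and> clique_number (proper_reduced_power_graph G)
           < clique_number (proper_reduced_power_graph (integer_mod_group n))
       \<and> chromatic_number (proper_reduced_power_graph G)
           < chromatic_number (proper_reduced_power_graph (integer_mod_group n))"
proof -
  interpret group G by fact
  let ?Z = "integer_mod_group n"
  interpret Z: group ?Z by simp
  have "n > 0"
    using assms(2,3) order_gt_0_iff_finite by blast
  have ord_G: "bigomega (ord u) < bigomega n" if "u \<in> carrier G" for u
    using that assms(2-4) \<open>n > 0\<close> ord_dvd_group_order[OF that] cyclic_group_if_ord_eq_order
    by (intro bigomega_strict_mono) auto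
  then have "bigomega n > 0"
    using one_closed by (metis less_nat_zero_code gr0I)
  then have "n > 1"
    using \<open>n > 0\<close> by (cases "n = 1") auto
  define m where "m = bigomega n - 1"
  have n: "bigomega n = Suc m"
    using \<open>bigomega n > 0\<close> by (simp add: m_def)

  have colour_G: "proper_coloring (reduced_power_graph G) (Suc m) (\<lambda>u. bigomega (ord u))"
    "proper_coloring (proper_reduced_power_graph G) m (\<lambda>u. bigomega (ord u) - 1)"
    using proper_coloring_reduced_power_graph[of m]
      proper_coloring_proper_reduced_power_graph[of m] ord_G n assms(2)
    by (simp_all only: less_Suc_eq_le)

  have fin_Z: "finite (carrier ?Z)" and "order ?Z = n"
    using \<open>n > 0\<close> by (auto simp: carrier_integer_mod_group order_def)
  then have ord_Z: "bigomega (Z.ord u) \<le> bigomega n" if "u \<in> carrier ?Z" for u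
    using Z.ord_dvd_group_order[OF that] \<open>n > 0\<close> by (intro bigomega_mono) auto
  note colour_Z = Z.proper_coloring_reduced_power_graph[OF fin_Z ord_Z]
    Z.proper_coloring_proper_reduced_power_graph[OF fin_Z ord_Z]
  have "1 \<in> carrier ?Z"
    using \<open>n > 1\<close> by simp
  then have clique_Z: "Suc (bigomega n) \<le> clique_number (reduced_power_graph ?Z)"
    "bigomega n \<le> clique_number (proper_reduced_power_graph ?Z)"
    using Z.clique_number_reduced_power_graph_ge[OF fin_Z]
      Z.clique_number_proper_reduced_power_graph_ge[OF fin_Z]
      ord_one_integer_mod_group[OF \<open>n > 1\<close>] by metis+

  have "clique_number (reduced_power_graph G) \<le> Suc m"
    "clique_number (proper_reduced_power_graph G) \<le> m"
    using clique_number_le_colours[OF _ colour_G(1)] clique_number_le_colours[OF _ colour_G(2)]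
      assms(2) by simp_all
  moreover have "chromatic_number (reduced_power_graph G) \<le> Suc m"
    "chromatic_number (proper_reduced_power_graph G) \<le> m"
    using chromatic_number_le_colours colour_G by blast+
  moreover have
    "clique_number (reduced_power_graph ?Z) \<le> chromatic_number (reduced_power_graph ?Z)"
    "clique_number (proper_reduced_power_graph ?Z) \<le> chromatic_number (proper_reduced_power_graph ?Z)"
    using clique_number_le_chromatic_number[OF _ colour_Z(1)]
      clique_number_le_chromatic_number[OF _ colour_Z(2)] fin_Z by simp_all
  ultimately show ?thesis
    using clique_Z n by linarith
qed

end
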